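(* Let $d$ be odd and let $\sigma_\diamond$ be a sign pattern of length $d+1$ with which the pair $(3,0)$ is compatible. If $\sigma_\diamond$ is not of the form $D(a,b,c)$ for any integers $a,b,c\geq1$ with $2a+2b+2c=d+1$, then the couple $(\sigma_\diamond,(3,0))$ is realizable, i.e. there is a monic degree-$d$ real polynomial with all coefficients non-zero, defining $\sigma_\diamond$, with exactly three real roots, all positive and simple.
   Context: A sign pattern of length $d+1$ is a sequence of $d+1$ symbols $+$/$-$ beginning with $+$; a monic polynomial $x^d+\sum_{j<d}a_jx^j$ with all $a_j\neq0$ defines the sign pattern $(+,\operatorname{sign}(a_{d-1}),\ldots,\operatorname{sign}(a_0))$. For a sign pattern with $c$ sign changes and $p$ sign preservations ($c+p=d$), a pair $(pos,neg)$ is compatible with it if $pos\le c$, $c-pos$ even, $neg\le p$, $p-neg$ even. A monic polynomial realizes $(\sigma,(pos,neg))$ if it has all coefficients non-zero, defines $\sigma$, has exactly $pos$ positive and $neg$ negative real roots, all simple, and no other real roots. For $d$ odd and integers $a,b,c\geq1$ with $2a+2b+2c=d+1$, $D(a,b,c)$ denotes the sign pattern (listed from the coefficient of $x^d$ down to the constant term) consisting of $2a$ pluses, followed by $b$ pairs "$-,+$", followed by $2c$ minuses. *)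

theory Defs
  imports "HOL-Computational_Algebra.Polynomial"
begin

text \<open>A sign pattern is a list of booleans (True = +, False = -), listed from the
coefficient of x^d down to the constant term.\<close>

definition sign_pattern :: "nat \<Rightarrow> bool list \<Rightarrow> bool" where
  "sign_pattern d \<sigma> \<longleftrightarrow> length \<sigma> = d + 1 \<and> hd \<sigma> = True"

definition sign_changes :: "bool list \<Rightarrow> nat" where
  "sign_changes \<sigma> = card {j. j + 1 < length \<sigma> \<and> \<sigma> ! j \<noteq> \<sigma> ! (j + 1)}"

definition sign_preservations :: "bool list \<Rightarrow> nat" where
  "sign_preservations \<sigma> = card {j. j + 1 < length \<sigma> \<and> \<sigma> ! j = \<sigma> ! (j + 1)}"

definition compatible :: "bool list \<Rightarrow> nat \<times> nat \<Rightarrow> bool" where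
  "compatible \<sigma> pn \<longleftrightarrow>
     (let c = sign_changes \<sigma>; p = sign_preservations \<sigma>; pos = fst pn; neg = snd pn in
       pos \<le> c \<and> even (c - pos) \<and> neg \<le> p \<and> even (p - neg))"

definition poly_sign_pattern :: "real poly \<Rightarrow> bool list" where
  "poly_sign_pattern P = map (\<lambda>j. coeff P (degree P - j) > 0) [0..<degree P + 1]"

definition realizes :: "real poly \<Rightarrow> bool list \<Rightarrow> nat \<times> nat \<Rightarrow> bool" where
  "realizes P \<sigma> pn \<longleftrightarrow>
     lead_coeff P = 1 \<and>
     (\<forall>j \<le> degree P. coeff P j \<noteq> 0) \<and>
     poly_sign_pattern P = \<sigma> \<and>
     card {x::real. x > 0 \<and> poly P x = 0} = fst pn \<and>
     card {x::real. x < 0 \<and> poly P x = 0} = snd pn \<and>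
     (\<forall>x::real. poly P x = 0 \<longrightarrow> order x P = 1)"

definition realizable :: "bool list \<Rightarrow> nat \<times> nat \<Rightarrow> bool" where
  "realizable \<sigma> pn \<longleftrightarrow> (\<exists>P. degree P + 1 = length \<sigma> \<and> realizes P \<sigma> pn)"

definition D_pattern :: "nat \<Rightarrow> nat \<Rightarrow> nat \<Rightarrow> bool list" where
  "D_pattern a b c = replicate (2*a) True @ concat (replicate b [False, True]) @ replicate (2*c) False"

end

theory Submission
  imports Defs "HOL-Analysis.Analysis"
begin

text \<open>
  Write s(k) for the sign of the coefficient of x^k. If there are indices d > i > j > 0 with
  s(i) = - and s(j) = +, where i is even or j is odd, then some four-term polynomial
  F = x^d - a x^i + b x^j - c with a, b, c > 0 has exactly three positive simple roots and no
  other real ones; adding small multiples of the lower monomials with the prescribed signs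
  keeps the number, the simplicity and the positivity of the roots.

  If there are no such indices, the signs at odd positions switch only once, from + to -, as k
  decreases, and so do the signs at even positions; moreover no odd position with a plus lies
  below an even position with a minus. Such a pattern is some D(a,b,c) or has at most one sign change.
\<close>

section \<open>Stability of simple real roots under small perturbations of lower degree\<close>

lemma eventually_perturbation_nonzero_compact:
  fixes F G :: "real poly"
  assumes "compact K" and nz: "\<And>x. x \<in> K \<Longrightarrow> poly F x \<noteq> 0"
  shows "\<forall>\<^sub>F e in at 0. \<forall>x\<in>K. poly (F + smult e G) x \<noteq> 0"
proof (cases "K = {}")
  case False
  have "continuous_on K (\<lambda>x. \<bar>poly F x\<bar>)" "continuous_on K (\<lambda>x. \<bar>poly G x\<bar>)"
    by (intro continuous_intros)+
  then obtain u v where u: "u \<in> K" "\<And>x. x \<in> K \<Longrightarrow> \<bar>poly F u\<bar> \<le> \<bar>poly F x\<bar>"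
    and v: "v \<in> K" "\<And>x. x \<in> K \<Longrightarrow> \<bar>poly G x\<bar> \<le> \<bar>poly G v\<bar>"
    using continuous_attains_inf[OF \<open>compact K\<close> False] continuous_attains_sup[OF \<open>compact K\<close> False]
    by metis
  have "((\<lambda>e. \<bar>e\<bar> * \<bar>poly G v\<bar>) \<longlongrightarrow> \<bar>0\<bar> * \<bar>poly G v\<bar>) (at 0)"
    by (intro tendsto_intros)
  then have "\<forall>\<^sub>F e in at 0. \<bar>e\<bar> * \<bar>poly G v\<bar> < \<bar>poly F u\<bar>"
    using nz[OF u(1)] by (intro order_tendstoD) auto
  then show ?thesis
  proof eventually_elim
    case (elim e)
    show ?case
    proof
      fix x assume x: "x \<in> K"
      have "\<bar>e * poly G x\<bar> \<le> \<bar>e\<bar> * \<bar>poly G v\<bar>"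
        using v(2)[OF x] by (simp add: abs_mult mult_left_mono)
      then show "poly (F + smult e G) x \<noteq> 0"
        using elim u(2)[OF x] by auto
    qed
  qed
qed simp

text \<open>Confines the real roots of all \<open>F + smult e G\<close> with \<open>e\<close>
  between -1 and 1 to one bounded interval that does not depend on \<open>e\<close>.\<close>

lemma lower_degree_poly_dominated:
  fixes F G :: "real poly"
  assumes "degree G < degree F"
  obtains R where "\<And>x. \<bar>x\<bar> > R \<Longrightarrow> \<bar>poly G x\<bar> < \<bar>poly F x\<bar>"
proof -
  have "((\<lambda>x. poly G x / poly F x) \<longlongrightarrow> 0) at_infinity"
    using poly_divide_tendsto_0_at_infinity[OF assms] .
  then have "\<forall>\<^sub>F x in at_infinity. \<bar>poly G x / poly F x\<bar> < 1"
    by (intro order_tendstoD(2)[OF tendsto_rabs_zero]) auto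
  moreover have "\<forall>\<^sub>F x in at_infinity. poly F x \<noteq> 0"
    using assms by (intro filterlim_at_infinity_imp_eventually_ne[OF filterlim_poly_at_infinity]) auto
  ultimately have "\<forall>\<^sub>F x in at_infinity. \<bar>poly G x\<bar> < \<bar>poly F x\<bar>"
    by eventually_elim (simp add: abs_divide divide_less_eq split: if_splits)
  then obtain b where b: "\<And>x. b \<le> norm x \<Longrightarrow> \<bar>poly G x\<bar> < \<bar>poly F x\<bar>"
    unfolding eventually_at_infinity by blast
  show thesis
    by (rule that[of b]) (use b in auto)
qed

lemma poly_Rolle:
  fixes p :: "real poly"
  assumes "a < b" "poly p a = 0" "poly p b = 0"
  shows "\<exists>x>a. x < b \<and> poly (pderiv p) x = 0"
  using poly_MVT[OF assms(1), of p] assms by auto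

text \<open>A nowhere vanishing derivative has constant sign on the interval. By the mean value
  theorem the two values are minus and plus \<delta> times values of that derivative.\<close>

lemma simple_root_sign_change:
  fixes F :: "real poly"
  assumes "0 < \<delta>" "poly F r = 0"
    and nz: "\<And>x. \<bar>x - r\<bar> \<le> \<delta> \<Longrightarrow> poly (pderiv F) x \<noteq> 0"
  shows "poly F (r - \<delta>) * poly F (r + \<delta>) < 0"
proof -
  obtain x y where x: "r - \<delta> < x" "x < r" "poly F r - poly F (r - \<delta>) = \<delta> * poly (pderiv F) x"
    and y: "r < y" "y < r + \<delta>" "poly F (r + \<delta>) - poly F r = \<delta> * poly (pderiv F) y"
    using poly_MVT[of "r - \<delta>" r F] poly_MVT[of r "r + \<delta>" F] \<open>0 < \<delta>\<close> by auto
  have "\<not> poly (pderiv F) x * poly (pderiv F) y < 0"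
    using poly_IVT[of x y "pderiv F"] x y nz by force
  moreover have "poly (pderiv F) x \<noteq> 0" "poly (pderiv F) y \<noteq> 0"
    using nz x y by auto
  ultimately have "poly (pderiv F) x * poly (pderiv F) y > 0"
    by (metis linorder_neqE_linordered_idom mult_eq_0_iff)
  then have "\<delta> * \<delta> * (poly (pderiv F) x * poly (pderiv F) y) > 0"
    using \<open>0 < \<delta>\<close> by simp
  moreover have "poly F (r - \<delta>) = - (\<delta> * poly (pderiv F) x)" "poly F (r + \<delta>) = \<delta> * poly (pderiv F) y"
    using x y assms by auto
  ultimately show ?thesis
    by (simp add: mult.commute mult.left_commute)
qed

text \<open>For small \<open>e\<close> every root of the perturbed polynomial lies close to a root
  of \<open>F\<close>. Each root of \<open>F\<close> has a new root nearby because of the sign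
  change around it, and only one because the derivative stays nonzero there; this also makes the new
  roots simple.\<close>

lemma simple_roots_perturbation:
  fixes F G :: "real poly"
  assumes deg: "degree G < degree F"
    and simple: "\<And>x. poly F x = 0 \<Longrightarrow> poly (pderiv F) x \<noteq> 0"
    and "0 < \<delta>'"
  shows "\<forall>\<^sub>F e in at 0. rsquarefree (F + smult e G) \<and>
    (\<exists>f. bij_betw f {x. poly F x = 0} {x. poly (F + smult e G) x = 0} \<and>
         (\<forall>r. poly F r = 0 \<longrightarrow> \<bar>f r - r\<bar> < \<delta>'))"
proof -
  define Z where "Z = {x. poly F x = 0}"
  have "F \<noteq> 0" using deg by auto
  then have "finite Z" unfolding Z_def by (rule poly_roots_finite)
  have "\<exists>\<delta>>0. \<forall>x. \<bar>x - r\<bar> \<le> \<delta> \<longrightarrow> poly (pderiv F) x \<noteq> 0" if "r \<in> Z" for r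
  proof -
    have "open {x. poly (pderiv F) x \<noteq> 0}"
      by (intro open_Collect_neq continuous_intros)
    moreover have "r \<in> {x. poly (pderiv F) x \<noteq> 0}" using that simple Z_def by auto
    ultimately obtain \<delta> where "\<delta> > 0" "cball r \<delta> \<subseteq> {x. poly (pderiv F) x \<noteq> 0}"
      using open_contains_cball by blast
    then show ?thesis by (intro exI[of _ \<delta>]) (auto simp: subset_iff dist_real_def abs_minus_commute)
  qed
  \<comment> \<open>The condition on \<delta> is inherited by smaller values, so the finitely many
    roots admit a common \<delta>.\<close>
  then have "\<forall>\<^sub>F \<delta> in at_right 0. \<forall>x. \<bar>x - r\<bar> \<le> \<delta> \<longrightarrow> poly (pderiv F) x \<noteq> 0" if "r \<in> Z" for r
    using that unfolding eventually_at_right_field by (meson less_imp_le order_trans)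
  then have "\<forall>\<^sub>F \<delta> in at_right 0. \<forall>r\<in>Z. \<forall>x. \<bar>x - r\<bar> \<le> \<delta> \<longrightarrow> poly (pderiv F) x \<noteq> 0"
    using \<open>finite Z\<close> by (simp add: eventually_ball_finite_distrib)
  moreover have "\<forall>\<^sub>F \<delta> in at_right 0. 0 < \<delta> \<and> \<delta> < \<delta>'"
    using \<open>0 < \<delta>'\<close> unfolding eventually_at_right_field by blast
  ultimately have "\<forall>\<^sub>F \<delta> in at_right 0. (\<forall>r\<in>Z. \<forall>x. \<bar>x - r\<bar> \<le> \<delta> \<longrightarrow> poly (pderiv F) x \<noteq> 0)
      \<and> 0 < \<delta> \<and> \<delta> < \<delta>'"
    by (rule eventually_conj)
  then obtain \<delta> where \<delta>: "0 < \<delta>" "\<delta> < \<delta>'"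
      "\<And>r x. r \<in> Z \<Longrightarrow> \<bar>x - r\<bar> \<le> \<delta> \<Longrightarrow> poly (pderiv F) x \<noteq> 0"
    using eventually_happens'[OF trivial_limit_at_right_real] by blast
  obtain R where R: "\<And>x. \<bar>x\<bar> > R \<Longrightarrow> \<bar>poly G x\<bar> < \<bar>poly F x\<bar>"
    using lower_degree_poly_dominated[OF deg] by blast
  define K where "K = {-R..R} - (\<Union>r\<in>Z. ball r \<delta>)"
  have "compact K" unfolding K_def by (intro compact_diff compact_Icc open_UN ballI open_ball)
  moreover have "poly F x \<noteq> 0" if "x \<in> K" for x
    using that \<delta>(1) unfolding K_def Z_def by force
  ultimately have E1: "\<forall>\<^sub>F e in at 0. \<forall>x\<in>K. poly (F + smult e G) x \<noteq> 0"
    by (rule eventually_perturbation_nonzero_compact)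
  have "compact (\<Union>r\<in>Z. cball r \<delta>)"
    using \<open>finite Z\<close> by (intro compact_UN) auto
  moreover have "poly (pderiv F) x \<noteq> 0" if "x \<in> (\<Union>r\<in>Z. cball r \<delta>)" for x
    using that \<delta>(3) by (auto simp: dist_real_def abs_minus_commute)
  ultimately have "\<forall>\<^sub>F e in at 0. \<forall>x\<in>(\<Union>r\<in>Z. cball r \<delta>). poly (pderiv F + smult e (pderiv G)) x \<noteq> 0"
    by (rule eventually_perturbation_nonzero_compact)
  then have E2: "\<forall>\<^sub>F e in at 0. \<forall>x\<in>(\<Union>r\<in>Z. cball r \<delta>). poly (pderiv (F + smult e G)) x \<noteq> 0"
    by (simp only: pderiv_add pderiv_smult)
  have "\<forall>\<^sub>F e in at 0. poly (F + smult e G) (r - \<delta>) * poly (F + smult e G) (r + \<delta>) < 0"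
    if "r \<in> Z" for r
  proof -
    have "((\<lambda>e. (poly F (r - \<delta>) + e * poly G (r - \<delta>)) * (poly F (r + \<delta>) + e * poly G (r + \<delta>)))
        \<longlongrightarrow> (poly F (r - \<delta>) + 0 * poly G (r - \<delta>)) * (poly F (r + \<delta>) + 0 * poly G (r + \<delta>))) (at 0)"
      by (intro tendsto_intros)
    moreover have "poly F (r - \<delta>) * poly F (r + \<delta>) < 0"
      using simple_root_sign_change[OF \<delta>(1)] \<delta>(3) that Z_def by blast
    ultimately show ?thesis by (auto dest: order_tendstoD(2))
  qed
  then have E3: "\<forall>\<^sub>F e in at 0. \<forall>r\<in>Z.
      poly (F + smult e G) (r - \<delta>) * poly (F + smult e G) (r + \<delta>) < 0"
    using \<open>finite Z\<close> by (simp add: eventually_ball_finite_distrib)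
  have E4: "\<forall>\<^sub>F e in at (0::real). \<bar>e\<bar> < 1"
    by (auto simp: eventually_at intro!: exI[of _ 1])
  from E1 E2 E3 E4 show ?thesis
  proof eventually_elim
    case (elim e)
    define P where "P = F + smult e G"
    note elim = elim[folded P_def]
    \<comment> \<open>Beyond \<open>R\<close> the term \<open>e * poly G x\<close> is too small to
      cancel \<open>poly F x\<close>; within the interval the set \<open>K\<close> is free of
      roots.\<close>
    have near: "\<exists>r\<in>Z. \<bar>x - r\<bar> < \<delta>" if "poly P x = 0" for x
    proof -
      have "\<bar>x\<bar> \<le> R"
      proof (rule ccontr)
        assume "\<not> \<bar>x\<bar> \<le> R"
        then have "\<bar>poly G x\<bar> < \<bar>poly F x\<bar>" using R by auto
        moreover have "\<bar>e * poly G x\<bar> \<le> \<bar>poly G x\<bar>"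
          using elim(4) by (simp add: abs_mult mult_left_le_one_le)
        ultimately show False using that unfolding P_def by auto
      qed
      then show ?thesis
        using elim(1) that unfolding K_def by (force simp: dist_real_def abs_minus_commute)
    qed
    have simple': "poly (pderiv P) x \<noteq> 0" if "r \<in> Z" "\<bar>x - r\<bar> \<le> \<delta>" for x r
      using elim(2) that by (force simp: dist_real_def abs_minus_commute)
    have "\<exists>x. poly P x = 0 \<and> \<bar>x - r\<bar> < \<delta>" if "r \<in> Z" for r
      using poly_IVT[of "r - \<delta>" "r + \<delta>" P] elim(3) that \<delta>(1) by (force simp: abs_less_iff)
    then obtain f where f: "\<And>r. r \<in> Z \<Longrightarrow> poly P (f r) = 0" "\<And>r. r \<in> Z \<Longrightarrow> \<bar>f r - r\<bar> < \<delta>"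
      by metis
    have uniq: "x = y" if "r \<in> Z" "poly P x = 0" "poly P y = 0" "\<bar>x - r\<bar> < \<delta>" "\<bar>y - r\<bar> < \<delta>" for x y r
      using that
    proof (induction x y rule: linorder_wlog)
      case (le x y)
      show ?case
      proof (rule ccontr)
        assume "x \<noteq> y"
        then obtain z where "x < z" "z < y" "poly (pderiv P) z = 0"
          using poly_Rolle[of x y P] le by auto
        then show False using simple'[of r z] le by auto
      qed
    qed auto
    \<comment> \<open>Two roots of \<open>F\<close> closer than this would have a zero of the
      derivative between them, within \<delta> of one of them. So the neighbourhoods are disjoint,
      which makes \<open>f\<close> injective.\<close>
    have separated: "2 * \<delta> \<le> s - r" if rs: "r \<in> Z" "s \<in> Z" "r < s" for r s
    proof (rule ccontr)
      assume *: "\<not> 2 * \<delta> \<le> s - r"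
      obtain z where z: "r < z" "z < s" "poly (pderiv F) z = 0"
        using poly_Rolle[of r s F] rs unfolding Z_def by blast
      have "\<bar>z - r\<bar> \<le> \<delta> \<or> \<bar>z - s\<bar> \<le> \<delta>" using * z by auto
      then show False using \<delta>(3) rs z by blast
    qed
    have "bij_betw f Z {x. poly P x = 0}"
      unfolding bij_betw_def
    proof
      show "inj_on f Z"
      proof (rule inj_onI)
        fix r s assume "r \<in> Z" "s \<in> Z" "f r = f s"
        then show "r = s"
          using f(2)[of r] f(2)[of s] separated[of r s] separated[of s r] by linarith
      qed
      show "f ` Z = {x. poly P x = 0}"
      proof (rule antisym)
        show "{x. poly P x = 0} \<subseteq> f ` Z"
        proof
          fix x assume "x \<in> {x. poly P x = 0}"
          then have x: "poly P x = 0" by simp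
          then obtain r where r: "r \<in> Z" "\<bar>x - r\<bar> < \<delta>" using near by blast
          show "x \<in> f ` Z"
            using uniq[OF r(1) x f(1)[OF r(1)] r(2) f(2)[OF r(1)]] r(1) by blast
        qed
      qed (use f(1) in auto)
    qed
    moreover have "rsquarefree P"
      using near simple' unfolding rsquarefree_roots by (meson less_imp_le)
    moreover have "\<forall>r. poly F r = 0 \<longrightarrow> \<bar>f r - r\<bar> < \<delta>'"
      by (intro allI impI less_trans[OF f(2) \<delta>(2)]) (simp add: Z_def)
    ultimately show ?case
      unfolding P_def Z_def by blast
  qed
qed

section \<open>Four-term polynomials with exactly three real roots, all positive\<close>

lemma trinomial_no_three_positive_roots:
  fixes A B C :: real
  assumes "n < m" "0 < n" "0 < A" "0 < B" and xyz: "0 < x" "x < y" "y < z"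
    and roots: "A * x ^ m - B * x ^ n + C = 0" "A * y ^ m - B * y ^ n + C = 0"
      "A * z ^ m - B * z ^ n + C = 0"
  shows False
proof -
  define h where "h = monom A m - monom B n + monom C 0"
  have h: "poly h t = A * t ^ m - B * t ^ n + C" for t
    by (simp add: h_def poly_monom)
  have h': "poly (pderiv h) t = m * A * t ^ (m - 1) - n * B * t ^ (n - 1)" for t
    by (simp add: h_def pderiv_add pderiv_diff pderiv_monom poly_monom)
  obtain u v where u: "x < u" "u < y" "poly (pderiv h) u = 0"
    and v: "y < v" "v < z" "poly (pderiv h) v = 0"
    using poly_Rolle[of x y h] poly_Rolle[of y z h] xyz roots unfolding h by blast
  \<comment> \<open>Divided by \<open>t ^ (n - 1)\<close>, the derivative is strictly increasing for
    positive \<open>t\<close>, so it has at most one positive zero, whereas Rolle provides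
    two.\<close>
  have "m * A * t ^ (m - n) = n * B" if "0 < t" "poly (pderiv h) t = 0" for t :: real
  proof -
    have "t ^ (m - 1) = t ^ (m - n) * t ^ (n - 1)"
      using assms by (simp flip: power_add)
    then have "t ^ (n - 1) * (m * A * t ^ (m - n) - n * B) = 0"
      using that(2) unfolding h' by (simp add: algebra_simps)
    then show ?thesis using that(1) by simp
  qed
  then have "m * A * u ^ (m - n) = m * A * v ^ (m - n)"
    using u v xyz by simp
  moreover have "u ^ (m - n) < v ^ (m - n)"
    using u v xyz assms by (intro power_strict_mono) auto
  ultimately show False using assms by simp
qed

text \<open>The derivative is a power of \<open>x\<close> times a trinomial, so it has at most two
  positive zeros, and by Rolle \<open>F\<close> has at most three positive roots. The signs at 0,
  \<open>p\<close>, \<open>q\<close> and infinity produce three, and \<open>neg\<close> excludes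
  negative ones.\<close>

lemma four_term_poly_three_simple_roots:
  fixes a b c :: real
  assumes "i < d" "j < i" "0 < j" "0 < a" "0 < c"
  defines "F \<equiv> monom 1 d - monom a i + monom b j - monom c 0"
  assumes neg: "\<And>x. x < 0 \<Longrightarrow> poly F x < 0"
    and pq: "0 < p" "p < q" "poly F p > 0" "poly F q < 0"
  obtains r1 r2 r3 where "0 < r1" "r1 < r2" "r2 < r3" "{x. poly F x = 0} = {r1, r2, r3}"
    "\<And>x. poly F x = 0 \<Longrightarrow> poly (pderiv F) x \<noteq> 0"
proof -
  have F: "poly F x = x ^ d - a * x ^ i + b * x ^ j - c" for x :: real
    by (simp add: F_def poly_monom)
  have F': "poly (pderiv F) x = d * x ^ (d - 1) - i * a * x ^ (i - 1) + j * b * x ^ (j - 1)" for x :: real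
    by (simp add: F_def pderiv_add pderiv_diff pderiv_monom poly_monom)
  have F'_root: "d * x ^ (d - j) - i * a * x ^ (i - j) + j * b = 0"
    if "0 < x" "poly (pderiv F) x = 0" for x :: real
  proof -
    have "x ^ (d - 1) = x ^ (d - j) * x ^ (j - 1)" "x ^ (i - 1) = x ^ (i - j) * x ^ (j - 1)"
      using assms(1-3) by (simp_all flip: power_add)
    then have "x ^ (j - 1) * (d * x ^ (d - j) - i * a * x ^ (i - j) + j * b) = 0"
      using that(2) unfolding F' by (simp add: algebra_simps)
    then show ?thesis using that(1) by simp
  qed
  have F'_no_three: False if "0 < x" "x < y" "y < z"
      "poly (pderiv F) x = 0" "poly (pderiv F) y = 0" "poly (pderiv F) z = 0" for x y z :: real
    using trinomial_no_three_positive_roots[of "i - j" "d - j" "real d" "i * a" x y z "j * b"]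
      F'_root[of x] F'_root[of y] F'_root[of z] that assms(1-4)
      diff_less_mono[of i d j] by simp
  have F_no_four: False if wxyz: "0 < w" "w < x" "x < y" "y < z"
      "poly F w = 0" "poly F x = 0" "poly F y = 0" "poly F z = 0" for w x y z :: real
  proof -
    obtain s t u where "w < s" "s < x" "poly (pderiv F) s = 0"
      "x < t" "t < y" "poly (pderiv F) t = 0" "y < u" "u < z" "poly (pderiv F) u = 0"
      using poly_Rolle[of w x F] poly_Rolle[of x y F] poly_Rolle[of y z F] wxyz by blast
    then show False using F'_no_three[of s t u] wxyz by linarith
  qed
  have deg: "degree F = d"
  proof -
    have "degree (- monom a i + monom b j - monom c 0) < d"
      using assms(1-3) by (intro degree_diff_less degree_add_less) (auto intro: le_less_trans[OF degree_monom_le])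
    then have "degree (monom 1 d + (- monom a i + monom b j - monom c 0)) = degree (monom (1::real) d)"
      by (intro degree_add_eq_left) (simp add: degree_monom_eq)
    then show ?thesis by (simp add: F_def degree_monom_eq algebra_simps)
  qed
  have "lead_coeff F = 1"
    using assms(1-3) unfolding deg by (simp add: F_def)
  then obtain N where N: "\<And>x. x \<ge> N \<Longrightarrow> poly F x \<ge> 1"
    using poly_pinfty_gt_lc[of F] by auto
  have F0: "poly F 0 < 0" using assms(1-5) by (simp add: F zero_power)
  obtain r1 where r1: "0 < r1" "r1 < p" "poly F r1 = 0"
    using poly_IVT_pos[OF pq(1) F0 pq(3)] by blast
  obtain r2 where r2: "p < r2" "r2 < q" "poly F r2 = 0"
    using poly_IVT_neg[OF pq(2-4)] by blast
  obtain r3 where r3: "q < r3" "poly F r3 = 0"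
    using poly_IVT_pos[of q "max N (q + 1)" F] N[of "max N (q + 1)"] pq(4) by force
  have pos: "x > 0" if "poly F x = 0" for x :: real
    using that neg[of x] F0 by (cases x "0::real" rule: linorder_cases) auto
  have roots: "x = r1 \<or> x = r2 \<or> x = r3" if "poly F x = 0" for x :: real
    using F_no_four[of x r1 r2 r3] F_no_four[of r1 x r2 r3] F_no_four[of r1 r2 x r3]
      F_no_four[of r1 r2 r3 x] pos[OF that] that r1 r2 r3 by fastforce
  obtain s t where s: "r1 < s" "s < r2" "poly (pderiv F) s = 0"
    and t: "r2 < t" "t < r3" "poly (pderiv F) t = 0"
    using poly_Rolle[of r1 r2 F] poly_Rolle[of r2 r3 F] r1 r2 r3 by auto
  \<comment> \<open>A multiple root would be a third positive zero of the derivative, besides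
    \<open>s\<close> and \<open>t\<close>, which lie strictly between the roots.\<close>
  have "poly (pderiv F) x \<noteq> 0" if "poly F x = 0" for x :: real
    using F'_no_three[of r1 s t] F'_no_three[of s r2 t] F'_no_three[of s t r3] roots[OF that]
      s t r1 by auto
  then show thesis
    using that[of r1 r2 r3] r1 r2 r3 roots by auto
qed

section \<open>Choice of the coefficients of the four-term polynomial\<close>

lemma weighted_power_mean_strict:
  fixes x :: real
  assumes "0 < n" "n < m" "0 \<le> x" "x \<noteq> 1"
  shows "0 < n * x ^ m - m * x ^ n + (real m - n)"
proof -
  define f where "f = (\<lambda>x::real. n * x ^ m - m * x ^ n + (real m - n))"
  have f1: "f 1 = 0" by (simp add: f_def)
  \<comment> \<open>For positive \<open>t\<close> the derivative has the sign of
    \<open>t ^ (m - n) - 1\<close>, so 1, where \<open>f\<close> vanishes, is the strict minimum on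
    the nonnegative half-line.\<close>
  have deriv: "(f has_real_derivative m * n * t ^ (n - 1) * (t ^ (m - n) - 1)) (at t)" for t :: real
  proof -
    have "t ^ (m - 1) = t ^ (m - n) * t ^ (n - 1)"
      using assms by (simp flip: power_add)
    then show ?thesis
      unfolding f_def by (auto intro!: derivative_eq_intros simp: algebra_simps)
  qed
  have cont: "continuous_on S f" for S
    unfolding f_def by (intro continuous_intros)
  consider "x < 1" | "1 < x" using assms by linarith
  then have "f 1 < f x"
  proof cases
    case 1
    show ?thesis
    proof (rule DERIV_neg_imp_decreasing_open[OF 1 _ cont])
      fix t assume t: "x < t" "t < 1"
      then have "t ^ (m - n) < 1" using assms power_strict_mono[of t 1 "m - n"] by simp
      then have "m * n * t ^ (n - 1) * (t ^ (m - n) - 1) < 0"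
        using t assms by (intro mult_pos_neg) auto
      then show "\<exists>y. (f has_real_derivative y) (at t) \<and> y < 0" using deriv by blast
    qed
  next
    case 2
    show ?thesis
    proof (rule DERIV_pos_imp_increasing_open[OF 2 _ cont])
      fix t assume t: "1 < t" "t < x"
      then have "1 < t ^ (m - n)" using assms by (intro one_less_power) auto
      then have "m * n * t ^ (n - 1) * (t ^ (m - n) - 1) > 0"
        using t assms by (intro mult_pos_pos) auto
      then show "\<exists>y. (f has_real_derivative y) (at t) \<and> 0 < y" using deriv by blast
    qed
  qed
  then show ?thesis unfolding f1 by (simp add: f_def)
qed

lemma weighted_power_mean:
  fixes x :: real
  assumes "0 < n" "n < m" "0 \<le> x"
  shows "0 \<le> n * x ^ m - m * x ^ n + (real m - n)"
  using weighted_power_mean_strict[OF assms] by (cases "x = 1") auto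

text \<open>The assumption \<open>par\<close> excludes only odd \<open>i\<close> with even
  \<open>j\<close>. For even \<open>i\<close> and odd \<open>j\<close> each of the four terms is
  negative on the negative half-line; in the other two cases negativity there comes from an even,
  nonnegative trinomial.\<close>

lemma ex_four_term_coeffs:
  assumes "odd d" "i < d" "j < i" "0 < j" and par: "odd i \<Longrightarrow> odd j"
  obtains a b c p q :: real where "0 < a" "0 < b" "0 < c" "0 < p" "p < q"
    "p ^ d - a * p ^ i + b * p ^ j - c > 0" "q ^ d - a * q ^ i + b * q ^ j - c < 0"
    "\<And>x. x < 0 \<Longrightarrow> x ^ d - a * x ^ i + b * x ^ j - c < 0"
proof -
  consider "even i" "odd j" | "odd i" "odd j" | "even i" "even j" using par by blast
  then show thesis
  proof cases
    case 1
    \<comment> \<open>The coefficients \<open>2 ^ d\<close>, \<open>2 ^ d + 1\<close>, 1 give the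
      value 1 at the point 1. This estimate bounds the value at 2 by
      \<open>2 ^ d - 2 ^ d * 2 ^ j + 2 ^ j - 1\<close>, which is at most -1.\<close>
    have "(2::real) ^ j * 2 \<le> 2 ^ i"
      using \<open>j < i\<close> by (metis Suc_leI one_le_numeral power_Suc2 power_increasing)
    then have "(2::real) ^ d * 2 ^ j * 2 \<le> 2 ^ d * 2 ^ i" by simp
    moreover have "(2::real) ^ d * 2 ^ j \<ge> 2 ^ d * 2" 
      using \<open>0 < j\<close> self_le_power[of "2::real" j] by simp
    moreover have "(2::real) ^ j \<le> 2 ^ d" using assms by (intro power_increasing) auto
    ultimately have q: "(2::real) ^ d - 2 ^ d * 2 ^ i + (2 ^ d + 1) * 2 ^ j - 1 < 0"
      unfolding distrib_right by linarith
    show thesis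
    proof (rule that[of "2 ^ d" "2 ^ d + 1" 1 1 2])
      fix x :: real assume "x < 0"
      then have "x ^ d < 0" "x ^ i > 0" "x ^ j < 0"
        using 1 \<open>odd d\<close> by (auto simp: zero_less_power_eq)
      then have "2 ^ d * x ^ i > 0" "(2 ^ d + 1) * x ^ j < 0"
        by (simp, intro mult_pos_neg add_pos_pos) auto
      then show "x ^ d - 2 ^ d * x ^ i + (2 ^ d + 1) * x ^ j - 1 < 0"
        using \<open>x ^ d < 0\<close> by linarith
    qed (use q in \<open>auto intro: add_pos_pos\<close>)
  next
    case 2
    txt \<open>The trinomial \<open>\<phi>\<close> is even and nonnegative with double zero 1, so
      \<open>x ^ j * \<phi> x\<close> is odd, but not monotone on the positive half-line.\<close>
    define m where "m = d - j"
    define n where "n = i - j"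
    have mn: "0 < n" "n < m" "d = j + m" "i = j + n" using assms by (auto simp: m_def n_def)
    define \<phi> where "\<phi> = (\<lambda>x::real. n * x ^ m - m * x ^ n + (real m - n))"
    \<comment> \<open>Half the value of the first three terms at 1/2. As these vanish at 1, the
      polynomial takes the value \<open>c\<close> at 1/2 and \<open>- c\<close> at 1.\<close>
    define c where "c = (1/2) ^ j * \<phi> (1/2) / n / 2"
    have g: "x ^ d - m / n * x ^ i + (real m - n) / n * x ^ j = x ^ j * \<phi> x / n" for x
      using mn by (simp add: \<phi>_def power_add field_simps)
    have "\<phi> (1/2) > 0" unfolding \<phi>_def using weighted_power_mean_strict[OF mn(1,2)] by simp
    then have "c > 0" using mn by (simp add: c_def)
    have half: "(1/2) ^ j * \<phi> (1/2) / n = 2 * c" by (simp add: c_def)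
    show thesis
    proof (rule that[of "m / n" "(real m - n) / n" c "1/2" 1])
      show "(1/2) ^ d - m / n * (1/2) ^ i + (real m - n) / n * (1/2) ^ j - c > 0"
        unfolding g half using \<open>c > 0\<close> by simp
      show "1 ^ d - m / n * 1 ^ i + (real m - n) / n * 1 ^ j - c < 0"
        unfolding g using \<open>c > 0\<close> by (simp add: \<phi>_def)
    next
      fix x :: real assume "x < 0"
      have "even m" "even n" using 2 \<open>odd d\<close> mn by auto
      then have "\<phi> x = \<phi> (- x)" by (simp add: \<phi>_def)
      then have "\<phi> x \<ge> 0" unfolding \<phi>_def using weighted_power_mean[OF mn(1,2), of "- x"] \<open>x < 0\<close> by simp
      moreover have "x ^ j \<le> 0" using 2 \<open>x < 0\<close> by (simp add: power_le_zero_eq odd_pos)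
      ultimately have "x ^ j * \<phi> x / n \<le> 0"
        using mn by (simp add: divide_le_0_iff mult_le_0_iff del: power_le_zero_eq)
      then show "x ^ d - m / n * x ^ i + (real m - n) / n * x ^ j - c < 0"
        unfolding g using \<open>c > 0\<close> by simp
    qed (use mn \<open>c > 0\<close> in auto)
  next
    case 3
    txt \<open>\<open>x ^ d - K * \<phi> x\<close> is positive at the double zero 1 of \<open>\<phi>\<close>
      for every \<open>K\<close>, and negative at 2 for large \<open>K\<close>.\<close>
    define \<phi> where "\<phi> = (\<lambda>x::real. j * x ^ i - i * x ^ j + (real i - j))"
    define K where "K = 2 ^ d / \<phi> 2 + 1"
    have "\<phi> 2 > 0" unfolding \<phi>_def using weighted_power_mean_strict[OF \<open>0 < j\<close> \<open>j < i\<close>, of 2] by simp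
    then have "K > 0" by (simp add: K_def add_pos_pos)
    have g: "x ^ d - K * j * x ^ i + K * i * x ^ j - K * (real i - j) = x ^ d - K * \<phi> x" for x
      by (simp add: \<phi>_def algebra_simps)
    show thesis
    proof (rule that[of "K * j" "K * i" "K * (real i - j)" 1 2])
      show "1 ^ d - K * j * 1 ^ i + K * i * 1 ^ j - K * (real i - j) > 0"
        unfolding g by (simp add: \<phi>_def)
      show "2 ^ d - K * j * 2 ^ i + K * i * 2 ^ j - K * (real i - j) < 0"
        unfolding g using \<open>\<phi> 2 > 0\<close> by (simp add: K_def algebra_simps)
    next
      fix x :: real assume "x < 0"
      have "\<phi> x = \<phi> (- x)" using 3 by (simp add: \<phi>_def)
      then have "\<phi> x \<ge> 0"
        unfolding \<phi>_def using weighted_power_mean[OF \<open>0 < j\<close> \<open>j < i\<close>, of "- x"] \<open>x < 0\<close> by simp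
      then have "K * \<phi> x \<ge> 0" using \<open>K > 0\<close> by simp
      moreover have "x ^ d < 0" using \<open>odd d\<close> \<open>x < 0\<close> by simp
      ultimately show "x ^ d - K * j * x ^ i + K * i * x ^ j - K * (real i - j) < 0"
        unfolding g by linarith
    qed (use \<open>K > 0\<close> assms in auto)
  qed
qed

section \<open>From weakly correct coefficient signs to a realization\<close>

lemma realizes_perturbation_positive_roots:
  fixes F :: "real poly" and s :: "nat \<Rightarrow> bool"
  assumes deg: "degree F = d" and lead: "lead_coeff F = 1"
    and simple: "\<And>x. poly F x = 0 \<Longrightarrow> poly (pderiv F) x \<noteq> 0"
    and pos: "\<And>x. poly F x = 0 \<Longrightarrow> 0 < x"
    and sgn: "\<And>k. k < d \<Longrightarrow> if s k then 0 \<le> coeff F k else coeff F k \<le> 0"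
    and "0 < d" and "s d"
  shows "\<exists>P. degree P = d \<and> realizes P (map (\<lambda>t. s (d - t)) [0..<d + 1]) (card {x. poly F x = 0}, 0)"
proof -
  \<comment> \<open>The coefficients of \<open>F\<close> have the prescribed signs weakly, so adding
    a positive multiple of \<open>G\<close> makes all lower ones nonzero with the right sign and
    leaves the leading one unchanged.\<close>
  define G :: "real poly" where "G = (\<Sum>k<d. monom (if s k then 1 else - 1) k)"
  have G: "coeff G k = (if k < d then if s k then 1 else - 1 else 0)" for k
    by (simp add: G_def coeff_sum)
  have degG: "degree G < degree F"
    using \<open>0 < d\<close> deg G le_degree leading_coeff_0_iff
    by (metis coeff_0 degree_0 not_le)
  have "F \<noteq> 0" using lead by auto
  then have fin: "finite {x. poly F x = 0}" by (rule poly_roots_finite)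
  \<comment> \<open>Roots that move by less than the smallest root stay positive. The inserted 1
    covers the case without roots.\<close>
  define \<delta> where "\<delta> = Min (insert 1 {x. poly F x = 0})"
  have \<delta>: "0 < \<delta>" "\<And>x. poly F x = 0 \<Longrightarrow> \<delta> \<le> x"
    using fin pos unfolding \<delta>_def by (auto simp: Min_gr_iff)
  have "\<forall>\<^sub>F e in at_right 0. rsquarefree (F + smult e G) \<and>
    (\<exists>f. bij_betw f {x. poly F x = 0} {x. poly (F + smult e G) x = 0} \<and>
         (\<forall>r. poly F r = 0 \<longrightarrow> \<bar>f r - r\<bar> < \<delta>))"
    using simple_roots_perturbation[OF degG simple \<delta>(1)] by (simp only: eventually_at_split)
  then have "\<forall>\<^sub>F e in at_right 0. 0 < e \<and> rsquarefree (F + smult e G) \<and>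
    (\<exists>f. bij_betw f {x. poly F x = 0} {x. poly (F + smult e G) x = 0} \<and>
         (\<forall>r. poly F r = 0 \<longrightarrow> \<bar>f r - r\<bar> < \<delta>))"
    by (rule eventually_conj[OF eventually_at_right_less])
  then obtain e f where e: "0 < e" and sqf: "rsquarefree (F + smult e G)"
    and bij: "bij_betw f {x. poly F x = 0} {x. poly (F + smult e G) x = 0}"
    and f: "\<And>r. poly F r = 0 \<Longrightarrow> \<bar>f r - r\<bar> < \<delta>"
    using eventually_happens'[OF trivial_limit_at_right_real] by blast
  define P where "P = F + smult e G"
  have coeffP: "coeff P k = coeff F k + e * coeff G k" for k by (simp add: P_def)
  have degP: "degree P = d"
    unfolding P_def using degG deg e by (simp add: degree_add_eq_left)
  have P_sgn: "if s k then 0 < coeff P k else coeff P k < 0" if "k \<le> d" for k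
    using that sgn[of k] e \<open>s d\<close> lead unfolding coeffP G by (cases "k = d") (auto simp: deg)
  have roots_pos: "0 < x" if Px: "poly P x = 0" for x
  proof -
    obtain r where "poly F r = 0" "x = f r"
      using Px bij unfolding P_def bij_betw_def by blast
    then show ?thesis using f[of r] \<delta>(2)[of r] by auto
  qed
  have "poly_sign_pattern P = map (\<lambda>t. s (d - t)) [0..<d + 1]"
    unfolding poly_sign_pattern_def degP by (intro map_cong refl) (metis P_sgn diff_le_self less_asym)
  moreover have "lead_coeff P = 1" using lead deg by (simp add: degP coeffP G)
  moreover have "\<forall>k\<le>degree P. coeff P k \<noteq> 0"
  proof (intro allI impI)
    fix k assume "k \<le> degree P"
    then show "coeff P k \<noteq> 0" using P_sgn[of k] degP by (auto split: if_splits)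
  qed
  moreover have "card {x. 0 < x \<and> poly P x = 0} = card {x. poly F x = 0}"
  proof -
    have "{x. 0 < x \<and> poly P x = 0} = {x. poly P x = 0}" using roots_pos by blast
    then show ?thesis using bij_betw_same_card[OF bij] by (simp add: P_def)
  qed
  moreover have "card {x. x < 0 \<and> poly P x = 0} = 0"
  proof -
    have "{x. x < 0 \<and> poly P x = 0} = {}" using roots_pos less_asym by blast
    then show ?thesis by (simp only: card.empty)
  qed
  moreover have "\<forall>x. poly P x = 0 \<longrightarrow> order x P = 1"
    using sqf unfolding P_def rsquarefree_def by (metis order_root)
  ultimately have "realizes P (map (\<lambda>t. s (d - t)) [0..<d + 1]) (card {x. poly F x = 0}, 0)"
    unfolding realizes_def by simp
  then show ?thesis using degP by blast
qed

text \<open>The four prescribed signs are those of \<open>x ^ d - a * x ^ i + b * x ^ j - c\<close>.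
  Its other coefficients vanish, so the perturbation can give them any sign.\<close>

lemma realizes_three_positive_roots:
  assumes "odd d" "i < d" "j < i" "0 < j" and par: "odd i \<Longrightarrow> odd j"
    and s: "s d" "\<not> s i" "s j" "\<not> s 0"
  shows "\<exists>P. degree P = d \<and> realizes P (map (\<lambda>t. s (d - t)) [0..<d + 1]) (3, 0)"
proof -
  obtain a b c p q :: real where abc: "0 < a" "0 < b" "0 < c" "0 < p" "p < q"
    "p ^ d - a * p ^ i + b * p ^ j - c > 0" "q ^ d - a * q ^ i + b * q ^ j - c < 0"
    "\<And>x. x < 0 \<Longrightarrow> x ^ d - a * x ^ i + b * x ^ j - c < 0"
    using ex_four_term_coeffs[OF assms(1-5)] by blast
  define F where "F = monom 1 d - monom a i + monom b j - monom c 0"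
  have F: "poly F x = x ^ d - a * x ^ i + b * x ^ j - c" for x
    by (simp add: F_def poly_monom)
  have cF: "coeff F k = (if k = d then 1 else if k = i then - a else if k = j then b else if k = 0 then - c else 0)" for k
    using assms(2-4) by (simp add: F_def)
  obtain r1 r2 r3 where r: "0 < r1" "r1 < r2" "r2 < r3" "{x. poly F x = 0} = {r1, r2, r3}"
    "\<And>x. poly F x = 0 \<Longrightarrow> poly (pderiv F) x \<noteq> 0"
    using four_term_poly_three_simple_roots[OF assms(2-4) abc(1,3), of b p q, folded F_def] abc F by metis
  have deg: "degree F = d"
    using assms(2-4) by (intro antisym degree_le le_degree) (auto simp: cF)
  have "0 < x" if "poly F x = 0" for x
    using that r(1-4) by (metis (mono_tags, lifting) insert_iff empty_iff mem_Collect_eq less_trans)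
  moreover have "if s k then 0 \<le> coeff F k else coeff F k \<le> 0" if "k < d" for k
    using that abc(1-3) s by (auto simp: cF)
  moreover have "lead_coeff F = 1" "0 < d" using assms by (auto simp: deg cF)
  ultimately have "\<exists>P. degree P = d \<and>
      realizes P (map (\<lambda>t. s (d - t)) [0..<d + 1]) (card {x. poly F x = 0}, 0)"
    using realizes_perturbation_positive_roots[OF deg _ r(5)] s(1) by blast
  moreover have "card {x. poly F x = 0} = 3" unfolding r(4) using r(2,3) by simp
  ultimately show ?thesis by simp
qed

section \<open>Counting sign changes and reading off entries of \<open>D_pattern\<close>\<close>

lemma even_card_changes_iff:
  fixes f :: "nat \<Rightarrow> bool"
  shows "even (card {j. j < n \<and> f j \<noteq> f (Suc j)}) \<longleftrightarrow> f 0 = f n"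
proof (induction n)
  case (Suc n)
  have "{j. j < Suc n \<and> f j \<noteq> f (Suc j)} =
      (if f n = f (Suc n) then {j. j < n \<and> f j \<noteq> f (Suc j)} else insert n {j. j < n \<and> f j \<noteq> f (Suc j)})"
    by (auto simp: less_Suc_eq)
  then show ?case using Suc by auto
qed simp

lemma sign_changes_threshold:
  assumes "\<And>t. t < length \<sigma> \<Longrightarrow> \<sigma> ! t \<longleftrightarrow> t < u"
  shows "sign_changes \<sigma> \<le> 1"
proof -
  \<comment> \<open>For \<open>u = 0\<close> there is no change at all; otherwise the only possible
    one is between positions \<open>u - 1\<close> and \<open>u\<close>.\<close>
  have "{j. j + 1 < length \<sigma> \<and> \<sigma> ! j \<noteq> \<sigma> ! (j + 1)} \<subseteq> {u - 1}"
    using assms by auto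
  then have "sign_changes \<sigma> \<le> card {u - 1}"
    unfolding sign_changes_def by (intro card_mono) auto
  then show ?thesis by simp
qed

lemma concat_replicate_pair:
  "length (concat (replicate b [x, y])) = 2 * b"
  "t < 2 * b \<Longrightarrow> concat (replicate b [x, y]) ! t = (if even t then x else y)"
proof (induction b arbitrary: t)
  case (Suc b)
  {
    case 1
    show ?case using Suc by simp
  next
    case 2
    then show ?case using Suc(2)[of "t - 2"] by (auto simp: nth_Cons split: nat.split)
  }
qed auto

lemma length_D_pattern: "length (D_pattern a b c) = 2 * a + 2 * b + 2 * c"
  by (simp add: D_pattern_def concat_replicate_pair)

text \<open>The pairs start at the even index \<open>2 * a\<close>, so their pluses sit at odd
  indices.\<close>

lemma nth_D_pattern:
  "t < 2 * a + 2 * b + 2 * c \<Longrightarrow>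
    D_pattern a b c ! t \<longleftrightarrow> t < 2 * a \<or> t < 2 * a + 2 * b \<and> odd t"
  by (auto simp: D_pattern_def nth_append concat_replicate_pair)

section \<open>Analysis of the patterns that the four-term construction does not reach\<close>

theorem theorem5:
  fixes d :: nat and \<sigma> :: "bool list"
  assumes "odd d"
    and "sign_pattern d \<sigma>"
    and "compatible \<sigma> (3, 0)"
    and "\<not> (\<exists>a b c. a \<ge> 1 \<and> b \<ge> 1 \<and> c \<ge> 1 \<and> 2*a + 2*b + 2*c = d + 1 \<and> \<sigma> = D_pattern a b c)"
  shows "\<exists>P :: real poly. degree P = d \<and> realizes P \<sigma> (3, 0)"
proof (rule ccontr)
  assume contr: "\<not> ?thesis"
  define s where "s k = \<sigma> ! (d - k)" for k
  have len: "length \<sigma> = d + 1" using assms(2) by (simp add: sign_pattern_def)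
  have sd: "s d" using assms(2) len unfolding sign_pattern_def s_def
    by (metis diff_self_eq_0 hd_conv_nth length_0_conv add_is_0 one_neq_zero)
  have \<sigma>: "\<sigma> = map (\<lambda>t. s (d - t)) [0..<d + 1]"
    by (rule nth_equalityI) (auto simp: len s_def simp del: upt_Suc)
  have changes: "3 \<le> sign_changes \<sigma>" "odd (sign_changes \<sigma>)"
    using assms(3) by (auto simp: compatible_def Let_def)
  have s0: "\<not> s 0"
    using changes(2) even_card_changes_iff[of d "(!) \<sigma>"] sd
    by (simp add: sign_changes_def len s_def)
  \<comment> \<open>As the pattern is assumed not realizable, a minus above a plus at a positive
    exponent can occur only in the parity case left out by the construction.\<close>
  have no_four_term: "odd i \<and> even j" if "i < d" "j < i" "0 < j" "\<not> s i" "s j" for i j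
    using realizes_three_positive_roots[OF assms(1) that(1-3) _ sd that(4,5) s0] contr \<sigma> by metis
  define M where "M = d div 2"
  have d: "d = 2 * M + 1" using assms(1) unfolding M_def by presburger
  \<comment> \<open>\<open>2 * m + 1\<close> is the lowest odd exponent with a plus,
    \<open>2 * l\<close> the lowest even one. If no even exponent has a plus, \<open>l\<close> is
    \<open>M + 1\<close>, just beyond the range.\<close>
  define m where "m = (LEAST k. s (2 * k + 1))"
  define l where "l = (LEAST k. 1 \<le> k \<and> (s (2 * k) \<or> k = M + 1))"
  have m: "s (2 * m + 1)" "m \<le> M"
    unfolding m_def using sd d by (metis LeastI, metis Least_le)
  have l: "1 \<le> l" "s (2 * l) \<or> l = M + 1" "l \<le> M + 1"
    unfolding l_def by (metis (mono_tags, lifting) LeastI le_add2, metis (mono_tags, lifting) LeastI le_add2,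
      metis (mono_tags, lifting) Least_le le_add2)
  \<comment> \<open>Exponents of equal parity cannot have a minus above a plus by
    \<open>no_four_term\<close>, so each parity class switches once, the odd one at \<open>m\<close>
    and the even one at \<open>l\<close>.\<close>
  have odd_s: "s (2 * k + 1) \<longleftrightarrow> m \<le> k" if "k \<le> M" for k
  proof
    assume "m \<le> k"
    then show "s (2 * k + 1)"
      using no_four_term[of "2 * k + 1" "2 * m + 1"] m sd that d by (cases "k = m"; cases "k = M") auto
  qed (simp add: m_def Least_le)
  have even_s: "s (2 * k) \<longleftrightarrow> l \<le> k" if "k \<le> M" for k
  proof
    assume "l \<le> k"
    then show "s (2 * k)"
      using no_four_term[of "2 * k" "2 * l"] l that d by (cases "k = l") auto
  next
    assume "s (2 * k)"
    then show "l \<le> k" using s0 unfolding l_def by (cases "k = 0") (auto intro: Least_le)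
  qed
  \<comment> \<open>Otherwise the minus at the even exponent \<open>2 * (l - 1)\<close> would lie
    above the plus at the odd exponent \<open>2 * m + 1\<close>.\<close>
  have lm: "l \<le> m + 1"
  proof (rule ccontr)
    assume "\<not> l \<le> m + 1"
    then show False
      using no_four_term[of "2 * (l - 1)" "2 * m + 1"] even_s[of "l - 1"] m l d by (cases l) auto
  qed
  \<comment> \<open>As \<open>d\<close> is odd, even list positions carry odd exponents and are
    governed by \<open>m\<close>; odd positions are governed by \<open>l\<close>.\<close>
  have nth: "\<sigma> ! t \<longleftrightarrow> (if even t then t \<le> 2 * (M - m) else t < 2 * (M + 1 - l))" if "t < length \<sigma>" for t
  proof -
    have "\<sigma> ! t = s (d - t)" using that len by (simp add: s_def)
    also have "\<dots> \<longleftrightarrow> (if even t then t \<le> 2 * (M - m) else t < 2 * (M + 1 - l))"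
    proof (cases "even t")
      case True
      then obtain k where k: "t = 2 * k" by blast
      moreover have "d - 2 * k = 2 * (M - k) + 1" using that k len d by linarith
      ultimately show ?thesis using odd_s[of "M - k"] that len d m by auto
    next
      case False
      then obtain k where k: "t = 2 * k + 1" by (elim oddE)
      moreover have "d - (2 * k + 1) = 2 * (M - k)" using that k len d by linarith
      ultimately show ?thesis using even_s[of "M - k"] that len d l by auto
    qed
    finally show ?thesis .
  qed
  show False
  proof (cases "l < m")
    case True
    \<comment> \<open>All positions before \<open>2 * (M + 1 - m)\<close> are plus, the last
      \<open>2 * l\<close> are minus, and in between exactly the odd ones are plus.\<close>
    have "\<sigma> = D_pattern (M + 1 - m) (m - l) l"
    proof (rule nth_equalityI)
      fix t assume t: "t < length \<sigma>"
      have "\<sigma> ! t \<longleftrightarrow> (if even t then t \<le> 2 * (M - m) else t < 2 * (M + 1 - l))"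
        using nth t .
      also have "\<dots> \<longleftrightarrow> t < 2 * (M + 1 - m) \<or> t < 2 * (M + 1 - m) + 2 * (m - l) \<and> odd t"
        using True m l by (auto elim!: evenE oddE)
      also have "\<dots> = D_pattern (M + 1 - m) (m - l) l ! t"
        using t True m len d by (subst nth_D_pattern) auto
      finally show "\<sigma> ! t = D_pattern (M + 1 - m) (m - l) l ! t" .
    qed (use True m len d in \<open>simp add: length_D_pattern\<close>)
    moreover have "2 * (M + 1 - m) + 2 * (m - l) + 2 * l = d + 1" using True m d by simp
    moreover have "1 \<le> M + 1 - m" "1 \<le> m - l" using True m by auto
    ultimately show False using assms(4) l(1) by blast
  next
    case False
    \<comment> \<open>Now \<open>l = m\<close> or \<open>l = m + 1\<close>, and in both cases the
      two thresholds merge into one: all pluses precede all minuses, against the three changes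
      required by compatibility.\<close>
    have "sign_changes \<sigma> \<le> 1"
    proof (rule sign_changes_threshold)
      fix t assume t: "t < length \<sigma>"
      show "\<sigma> ! t \<longleftrightarrow> t < (if l = m then 2 * (M + 1 - m) else 2 * (M - m) + 1)"
        unfolding nth[OF t] using False lm m by (auto elim!: evenE oddE)
    qed
    then show False using changes(1) by simp
  qed
qed

end
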